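(* Let $n\ge 1$, let $\mathcal{L} \subset \mathbb{R}^{2n}$ be a Lagrangian subspace and $\mathbf{B}= (x_1, \ldots , x_n)$ any ordered basis of $\mathcal{L}$. Then the affine subspace $\mathbb{HK}(\mathbf{B})$ of $\mathbb{R}^{2n\times 2n}$ has dimension $$\dim \left( \mathbb{HK}(\mathbf{B}) \right) = \frac{n(n+1)}{2}.$$
   Context: $J_{2n} = \begin{bmatrix} 0 & I_n \\ -I_n & 0 \end{bmatrix} \in \mathbb{R}^{2n\times 2n}$. A subspace $\mathcal{L}\subset\mathbb{R}^{2n}$ is called isotropic if $x^TJ_{2n}y = 0$ for all $x,y\in\mathcal{L}$, and Lagrangian if it is isotropic and of dimension $n$. A matrix $H\in\mathbb{R}^{2n\times 2n}$ is called skew-Hamiltonian if $J_{2n}^TH^TJ_{2n} = H$. For an ordered basis $\mathbf{B}=(x_1,\ldots,x_n)$ of a Lagrangian subspace, $\mathbb{HK}(\mathbf{B})$ denotes the set of all skew-Hamiltonian matrices $H\in\mathbb{R}^{2n\times 2n}$ satisfying $Hx_k = x_{k+1}$ for all $k=1,\ldots,n-1$. It is an affine subspace $\widehat{H}+\mathcal{H}_0$ of $\mathbb{R}^{2n\times 2n}$, where, with $X_L=[\,x_1\;\cdots\;x_{n-1}\,]$, $X_R=[\,x_2\;\cdots\;x_n\,]$ and $A^+$ the Moore-Penrose pseudoinverse of $A$, $\widehat{H} = X_RX_L^+ + J_{2n}^T(X_RX_L^+)^TJ_{2n}$, and $\mathcal{H}_0 = \lbrace J_{2n}^TX_L^{\bot}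 S (X_L^{\bot})^T : S = -S^T \in \mathbb{R}^{(n+1)\times(n+1)} \rbrace$, the columns of $X_L^{\bot}\in\mathbb{R}^{2n\times(n+1)}$ being an orthonormal basis of $\textnormal{span}\lbrace x_1,\ldots,x_{n-1}\rbrace^{\bot}$. The dimension of the affine subspace is that of its direction space: $\dim(\mathbb{HK}(\mathbf{B})) = \dim(\mathcal{H}_0)$ over $\mathbb{R}$. (For $n=1$ the matrices $X_L,X_R$ have no columns and $X_RX_L^+$ is the zero matrix.) *)

theory Defs
  imports "HOL-Analysis.Analysis"
begin

text \<open>
  The space \<open>\<real>\<^sup>2\<^sup>n\<close> is \<open>real ^ ('n + 'n)\<close> with \<open>n = CARD('n)\<close>: the index type \<open>'n + 'n\<close>
  carries the block structure, \<open>Inl\<close> indexing the first \<open>n\<close> coordinates (rows, columns) and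
  \<open>Inr\<close> the last \<open>n\<close>. Since types are nonempty, \<open>n \<ge> 1\<close>.
\<close>

definition J2n :: "real ^ ('n::finite + 'n) ^ ('n + 'n)" where
  "J2n = (\<chi> i j. case (i, j) of
      (Inl a, Inl b) \<Rightarrow> 0
    | (Inl a, Inr b) \<Rightarrow> (mat 1 :: real ^ 'n ^ 'n) $ a $ b
    | (Inr a, Inl b) \<Rightarrow> - (mat 1 :: real ^ 'n ^ 'n) $ a $ b
    | (Inr a, Inr b) \<Rightarrow> 0)"

definition isotropic :: "(real ^ ('n::finite + 'n)) set \<Rightarrow> bool" where
  "isotropic L \<longleftrightarrow> subspace L \<and> (\<forall>x\<in>L. \<forall>y\<in>L. x \<bullet> (J2n *v y) = 0)"

definition lagrangian :: "(real ^ ('n::finite + 'n)) set \<Rightarrow> bool" where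
  "lagrangian L \<longleftrightarrow> isotropic L \<and> dim L = CARD('n)"

definition skew_hamiltonian :: "real ^ ('n::finite + 'n) ^ ('n + 'n) \<Rightarrow> bool" where
  "skew_hamiltonian H \<longleftrightarrow> transpose J2n ** transpose H ** J2n = H"

text \<open>
  An ordered basis \<open>(x\<^sub>1, \<dots>, x\<^sub>m)\<close> is a function on \<open>nat\<close> of which only the values at
  \<open>1, \<dots>, m\<close> matter. Independence of a set does not exclude repetitions in the family,
  hence the injectivity condition.
\<close>

definition ordered_basis :: "nat \<Rightarrow> (nat \<Rightarrow> 'a::real_vector) \<Rightarrow> 'a set \<Rightarrow> bool" where
  "ordered_basis m x L \<longleftrightarrow>
     inj_on x {1..m} \<and> independent (x ` {1..m}) \<and> span (x ` {1..m}) = L"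

definition HK :: "(nat \<Rightarrow> real ^ ('n::finite + 'n)) \<Rightarrow> (real ^ ('n + 'n) ^ ('n + 'n)) set" where
  "HK x = {H. skew_hamiltonian H \<and> (\<forall>k\<in>{1..<CARD('n)}. H *v x k = x (k + 1))}"

end

theory Submission
  imports Defs
begin

text \<open>
  A matrix \<open>H\<close> is skew-Hamiltonian iff \<open>K = J H\<close> is skew-symmetric, and \<open>H x\<^sub>k = x\<^sub>k\<^sub>+\<^sub>1\<close> becomes
  \<open>K x\<^sub>k = J x\<^sub>k\<^sub>+\<^sub>1\<close>. Isotropy gives \<open>x\<^sub>i \<bullet> J x\<^sub>k\<^sub>+\<^sub>1 = 0\<close>, so if \<open>M\<close> maps each \<open>x\<^sub>k\<close> to \<open>J x\<^sub>k\<^sub>+\<^sub>1\<close> and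
  has its range in the span of these images, then \<open>M\<^sup>T x\<^sub>k = 0\<close> and \<open>M - M\<^sup>T\<close> is a particular
  solution. The homogeneous solutions are the skew-symmetric \<open>K\<close> vanishing on the
  \<open>(n - 1)\<close>-dimensional span of \<open>x\<^sub>1, \<dots>, x\<^sub>n\<^sub>-\<^sub>1\<close>. With \<open>b\<^sub>0, \<dots>, b\<^sub>n\<close> an orthonormal basis of its
  orthogonal complement, the matrices \<open>b\<^sub>i b\<^sub>j\<^sup>T - b\<^sub>j b\<^sub>i\<^sup>T\<close> for \<open>i < j\<close> are an orthogonal basis of
  that space, of size \<open>n (n + 1) / 2\<close>.
\<close>

section \<open>Rank-one and skew-symmetric matrices\<close>

definition outer :: "real ^ 'm \<Rightarrow> real ^ 'n \<Rightarrow> real ^ 'n ^ 'm" where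
  "outer a b = (\<chi> i j. a $ i * b $ j)"

text \<open>For \<open>X\<close> the span of the first n - 1 basis vectors, this is the direction
  space of \<open>HK x\<close> transported by \<open>H \<mapsto> J2n ** H\<close>.\<close>

definition skew_null :: "(real ^ 'm) set \<Rightarrow> (real ^ 'm ^ 'm) set" where
  "skew_null X = {K. transpose K = - K \<and> (\<forall>v\<in>X. K *v v = 0)}"

lemma transpose_outer [simp]: "transpose (outer a b) = outer b a"
  by (simp add: outer_def transpose_def vec_eq_iff mult.commute)

lemma outer_mult_vec: "outer a b *v v = (b \<bullet> v) *\<^sub>R a"
  by (simp add: outer_def matrix_vector_mult_def vec_eq_iff inner_vec_def sum_distrib_left
      mult_ac)

text \<open>The inner product of matrices is entrywise, so pairing with a rank-one matrix evaluates
  the bilinear form of \<open>K\<close>.\<close>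

lemma inner_outer: "K \<bullet> outer a b = a \<bullet> (K *v b)"
  by (simp add: outer_def inner_vec_def matrix_vector_mult_def sum_distrib_left mult_ac)

lemma transpose_diff: "transpose (A - B) = transpose A - transpose (B :: real ^ 'n ^ 'm)"
  and transpose_plus: "transpose (A + B) = transpose A + transpose (B :: real ^ 'n ^ 'm)"
  by (simp_all add: transpose_def vec_eq_iff)

lemma minus_matrix_mult: "(- A) ** B = - (A ** (B :: real ^ 'p ^ 'n))"
  and matrix_mult_minus: "A ** (- B) = - (A ** (B :: real ^ 'p ^ 'n))"
  by (simp_all add: matrix_matrix_mult_def vec_eq_iff sum_negf)

lemma minus_matrix_vector_mult: "(- A) *v v = - (A *v (v :: real ^ 'n))"
  by (simp add: matrix_vector_mult_def vec_eq_iff sum_negf)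

lemma subspace_skew_null: "subspace (skew_null X)"
  unfolding subspace_def skew_null_def
  by (auto simp: transpose_plus transpose_scalar matrix_vector_mult_add_rdistrib
      scaleR_matrix_vector_assoc [symmetric]) (simp_all add: transpose_def vec_eq_iff)

lemma inner_skew:
  fixes K :: "real ^ 'm ^ 'm"
  assumes "transpose K = - K"
  shows "a \<bullet> (K *v b) = - (b \<bullet> (K *v a))"
proof -
  have "a \<bullet> (K *v b) = (transpose K *v a) \<bullet> b"
    by (simp add: dot_lmul_matrix)
  then show ?thesis
    unfolding assms by (simp add: minus_matrix_vector_mult inner_commute)
qed

section \<open>Dimension of the skew-symmetric matrices vanishing on a subspace\<close>

lemma card_ordered_pairs: "card (SIGMA j:{..<d}. {..<j}) = d choose 2"
proof -
  have "card (SIGMA j:{..<d}. {..<j}) = (\<Sum>j<d. j)"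
    by simp
  also have "\<dots> = d choose 2"
    by (induction d) (simp_all add: numeral_2_eq_2)
  finally show ?thesis .
qed

text \<open>Skewness together with vanishing on \<open>X\<close> confines the bilinear form of
  \<open>K\<close> to the orthogonal complement of \<open>X\<close>, where it is determined by its
  entries above the diagonal.\<close>

lemma dim_skew_null:
  fixes X :: "(real ^ 'm) set"
  assumes "subspace X"
  shows "dim (skew_null X) = (CARD('m) - dim X) choose 2"
proof -
  define V where "V = {v. \<forall>x\<in>X. orthogonal x v}"
  define d where "d = CARD('m) - dim X"
  have subV: "subspace V"
    unfolding V_def by (rule subspace_orthogonal_to_vectors)
  have dimV: "dim V = d"
    using dim_subspace_orthogonal_to_vectors [OF assms subspace_UNIV]
    by (simp add: V_def d_def)
  obtain B where B: "B \<subseteq> V" "pairwise orthogonal B" "\<And>v. v \<in> B \<Longrightarrow> norm v = 1"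
    "independent B" "card B = d" "span B = V"
    using orthonormal_basis_subspace [OF subV] dimV by metis
  have "finite B"
    using B(4) by (rule independent_imp_finite)
  then obtain b where b: "bij_betw b {..<d} B"
    using ex_bij_betw_nat_finite [of B] B(5) by (auto simp: atLeast0LessThan)
  have bB: "b i \<in> B" if "i < d" for i
    using b that by (auto simp: bij_betw_def)
  have b_inner: "b i \<bullet> b j = (if i = j then 1 else 0)" if "i < d" "j < d" for i j
  proof (cases "i = j")
    case True
    then show ?thesis
      using B(3) [OF bB [OF that(1)]] by (simp add: dot_square_norm)
  next
    case False
    then have "b i \<noteq> b j"
      using b that by (auto simp: bij_betw_def inj_on_def)
    then show ?thesis
      using B(2) bB that False by (simp add: pairwise_def orthogonal_def)
  qed
  define P where "P = (SIGMA j:{..<d}. {..<j})"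
  define E where "E = (\<lambda>(j, i). outer (b i) (b j) - outer (b j) (b i))"
  have E_inner: "E p \<bullet> E q = (if p = q then 2 else 0)" if pq: "p \<in> P" "q \<in> P" for p q
  proof -
    obtain j i where p: "p = (j, i)" "i < j" "j < d"
      using pq(1) by (auto simp: P_def)
    obtain l k where q: "q = (l, k)" "k < l" "l < d"
      using pq(2) by (auto simp: P_def)
    \<comment> \<open>A 2 by 2 Gram determinant. Its second product vanishes: i = l and j = k would
      give i < j = k < l = i.\<close>
    have "E p \<bullet> E q = 2 * ((b i \<bullet> b k) * (b j \<bullet> b l) - (b i \<bullet> b l) * (b j \<bullet> b k))"
      by (simp add: p(1) q(1) E_def inner_outer outer_mult_vec inner_diff_right
          matrix_vector_mult_diff_rdistrib inner_commute)
    then show ?thesis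
      using p q less_trans [OF p(2,3)] less_trans [OF q(2,3)] by (auto simp: b_inner)
  qed
  have injE: "inj_on E P"
  proof (rule inj_onI)
    fix p q assume "p \<in> P" "q \<in> P" "E p = E q"
    then show "p = q"
      using E_inner [of p q] E_inner [of q q] by (auto split: if_splits)
  qed
  have indE: "independent (E ` P)"
  proof (rule pairwise_orthogonal_independent)
    show "pairwise orthogonal (E ` P)"
      by (auto simp: pairwise_def orthogonal_def E_inner)
    show "0 \<notin> E ` P"
      using E_inner by force
  qed
  have E_mem: "E ` P \<subseteq> skew_null X"
  proof clarify
    fix j i assume "(j, i) \<in> P"
    then have "b i \<in> V" "b j \<in> V"
      using B(1) bB by (auto simp: P_def)
    then have "b i \<bullet> x = 0" "b j \<bullet> x = 0" if "x \<in> X" for x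
      using that by (auto simp: V_def orthogonal_def inner_commute)
    then show "E (j, i) \<in> skew_null X"
      by (simp add: E_def skew_null_def transpose_diff outer_mult_vec
          matrix_vector_mult_diff_rdistrib)
  qed
  \<comment> \<open>Otherwise some nonzero \<open>K\<close> in \<open>skew_null X\<close> is
    orthogonal to every \<open>E p\<close>; its bilinear form is shown to vanish on
    \<open>B\<close>, then on \<open>V\<close>, then everywhere.\<close>
  have "skew_null X \<subseteq> span (E ` P)"
  proof (rule ccontr)
    assume "\<not> ?thesis"
    moreover have "span (E ` P) \<subseteq> skew_null X"
      using E_mem subspace_skew_null by (rule span_minimal)
    ultimately have "span (E ` P) \<subset> span (skew_null X)"
      by (metis psubsetI span_eq_iff subspace_skew_null)
    then obtain K where K: "K \<noteq> 0" "K \<in> span (skew_null X)"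
      "\<And>y. y \<in> span (E ` P) \<Longrightarrow> orthogonal K y"
      using orthogonal_to_subspace_exists_gen by metis
    then have "K \<in> skew_null X"
      using subspace_skew_null [of X] by (metis span_eq_iff)
    then have skew: "transpose K = - K" and null: "\<And>x. x \<in> X \<Longrightarrow> K *v x = 0"
      by (auto simp: skew_null_def)
    \<comment> \<open>Orthogonality to \<open>E (j, i)\<close> equates the entries (i, j) and (j, i)
      of the form, while skewness makes them opposite.\<close>
    have less0: "b i \<bullet> (K *v b j) = 0" if "i < j" "j < d" for i j
    proof -
      have "E (j, i) \<in> span (E ` P)"
        using that by (intro span_base) (auto simp: P_def)
      then have "K \<bullet> E (j, i) = 0"
        using K(3) by (simp add: orthogonal_def)
      then show ?thesis
        using inner_skew [OF skew, of "b j" "b i"]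
        by (simp add: E_def inner_diff_right inner_outer)
    qed
    have b_K: "b i \<bullet> (K *v b j) = 0" if "i < d" "j < d" for i j
      using less0 [of i j] less0 [of j i] that inner_skew [OF skew, of "b i" "b j"]
      by (cases i j rule: linorder_cases) auto
    have BB: "u \<bullet> (K *v v) = 0" if uv: "u \<in> B" "v \<in> B" for u v
    proof -
      obtain i j where "i < d" "u = b i" "j < d" "v = b j"
        using b uv by (auto simp: bij_betw_def)
      with b_K show ?thesis
        by simp
    qed
    have BV: "u \<bullet> (K *v v) = 0" if "u \<in> B" "v \<in> V" for u v
    proof -
      \<comment> \<open>Transposing frees the second argument, so that vanishing passes from
        \<open>B\<close> to its span.\<close>
      have "(transpose K *v u) \<bullet> w = 0" if "w \<in> B" for w
        using BB [OF \<open>u \<in> B\<close> that] by (simp add: dot_lmul_matrix)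
      then have "orthogonal (transpose K *v u) v"
        using orthogonal_to_span [of v B "transpose K *v u"] that(2) B(6)
        unfolding orthogonal_def by blast
      then show ?thesis
        by (simp add: orthogonal_def dot_lmul_matrix)
    qed
    have VV: "u \<bullet> (K *v v) = 0" if "u \<in> V" "v \<in> V" for u v
    proof -
      have "orthogonal (K *v v) u"
        using orthogonal_to_span [of u B "K *v v"] that B(6) BV
        by (auto simp: orthogonal_def inner_commute)
      then show ?thesis
        by (simp add: orthogonal_def inner_commute)
    qed
    have decomp: "\<exists>x\<in>X. \<exists>v\<in>V. w = x + v" for w
      using subspace_sum_orthogonal_comp [OF assms]
      by (metis V_def UNIV_I orthogonal_comp_def set_plus_elim)
    have "u \<bullet> (K *v w) = 0" for u w
    proof -
      obtain x v where w: "x \<in> X" "v \<in> V" "w = x + v"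
        using decomp by blast
      obtain y z where u: "y \<in> X" "z \<in> V" "u = y + z"
        using decomp by blast
      \<comment> \<open>Of the four terms, two contain \<open>K *v x = 0\<close>, the one in z and v
        vanishes on \<open>V\<close>, and skewness turns the one in y and v into one containing
        \<open>K *v y = 0\<close>.\<close>
      show ?thesis
        using VV [OF u(2) w(2)] null [OF w(1)] null [OF u(1)] inner_skew [OF skew, of y v]
        by (simp add: u(3) w(3) matrix_vector_right_distrib inner_add_left)
    qed
    then have "K *v w = 0" for w
      using inner_eq_zero_iff by blast
    then have "K = 0"
      by (simp add: matrix_eq)
    with K(1) show False ..
  qed
  then have "dim (skew_null X) = card (E ` P)"
    using E_mem indE by (intro dim_unique) auto
  also have "\<dots> = d choose 2"
    using injE by (simp add: card_image P_def card_ordered_pairs del: card_SigmaI)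
  finally show ?thesis
    by (simp add: d_def)
qed

section \<open>The matrix \<open>J2n\<close> and skew-Hamiltonian matrices\<close>

lemma transpose_J2n: "transpose J2n = - (J2n :: real ^ ('n::finite + 'n) ^ ('n + 'n))"
  by (auto simp: transpose_def J2n_def vec_eq_iff mat_def split: sum.splits)

lemma J2n_squared: "J2n ** J2n = - (mat 1 :: real ^ ('n::finite + 'n) ^ ('n + 'n))"
proof -
  have split: "(\<Sum>k\<in>UNIV. f k) = (\<Sum>a\<in>UNIV. f (Inl a)) + (\<Sum>a\<in>UNIV. f (Inr a))"
    for f :: "'n + 'n \<Rightarrow> real"
    by (simp add: UNIV_Plus_UNIV [symmetric] sum.Plus del: UNIV_Plus_UNIV)
  have "(J2n ** J2n) $ i $ j = (- mat 1 :: real ^ ('n + 'n) ^ ('n + 'n)) $ i $ j" for i j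
    by (cases i; cases j)
      (simp_all add: matrix_matrix_mult_def split J2n_def mat_def if_distrib if_distribR
        sum.If_cases cong: if_cong)
  then show ?thesis
    by (simp add: vec_eq_iff)
qed

lemma J2n_transpose_mult:
  "transpose J2n ** J2n = (mat 1 :: real ^ ('n::finite + 'n) ^ ('n + 'n))"
  "J2n ** transpose J2n = (mat 1 :: real ^ ('n::finite + 'n) ^ ('n + 'n))"
  by (simp_all add: transpose_J2n minus_matrix_mult matrix_mult_minus J2n_squared)

lemma skew_hamiltonian_iff_skew:
  fixes H :: "real ^ ('n::finite + 'n) ^ ('n + 'n)"
  shows "skew_hamiltonian H \<longleftrightarrow> transpose (J2n ** H) = - (J2n ** H)"
proof -
  have "skew_hamiltonian H \<longleftrightarrow> transpose H ** J2n = J2n ** H"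
    unfolding skew_hamiltonian_def
    by (metis J2n_transpose_mult matrix_mul_assoc matrix_mul_lid)
  also have "\<dots> \<longleftrightarrow> transpose (J2n ** H) = - (J2n ** H)"
    by (simp add: matrix_transpose_mul transpose_J2n matrix_mult_minus)
  finally show ?thesis .
qed

lemma skew_matrix_extending:
  fixes f :: "real ^ 'm \<Rightarrow> real ^ 'm"
  assumes "independent B" and orth: "\<And>u v. u \<in> B \<Longrightarrow> v \<in> B \<Longrightarrow> u \<bullet> f v = 0"
  obtains K where "transpose K = - K" "\<And>v. v \<in> B \<Longrightarrow> K *v v = f v"
proof -
  obtain g where g: "linear g" "\<And>v. v \<in> B \<Longrightarrow> g v = f v" "range g = span (f ` B)"
    using linear_independent_extend_subspace [OF assms(1), of f] by blast
  define M where "M = matrix g"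
  have M: "M *v v = g v" for v
    unfolding M_def using g(1) by (simp add: matrix_works)
  have "transpose M *v v = 0" if "v \<in> B" for v
  proof -
    have "(transpose M *v v) \<bullet> w = 0" for w
    proof -
      have "orthogonal v (g w)"
        using orthogonal_to_span [of "g w" "f ` B" v] g(3) orth [OF that]
        by (auto simp: orthogonal_def)
      then show ?thesis
        by (simp add: dot_lmul_matrix M orthogonal_def)
    qed
    then show ?thesis
      using inner_eq_zero_iff by blast
  qed
  then show ?thesis
    using that [of "M - transpose M"] g(2)
    by (simp add: transpose_diff matrix_vector_mult_diff_rdistrib M)
qed

section \<open>The affine space \<open>HK x\<close> and its dimension\<close>

theorem corollary3:
  fixes L :: "(real ^ ('n::finite + 'n)) set"
    and x :: "nat \<Rightarrow> real ^ ('n + 'n)"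
  assumes "lagrangian L"
    and "ordered_basis CARD('n) x L"
  shows "affine (HK x) \<and>
         real_of_int (aff_dim (HK x)) = real CARD('n) * (real CARD('n) + 1) / 2"
proof -
  let ?n = "CARD('n)"
  let ?J = "J2n :: real ^ ('n + 'n) ^ ('n + 'n)"
  define B where "B = x ` {1..<?n}"
  have inj: "inj_on x {1..?n}" and ind: "independent (x ` {1..?n})"
    and spn: "span (x ` {1..?n}) = L"
    using assms(2) by (auto simp: ordered_basis_def)
  have injB: "inj_on x {1..<?n}"
    using inj by (rule inj_on_subset) auto
  have indB: "independent B"
    using ind by (rule independent_mono) (auto simp: B_def)
  have xL: "x k \<in> L" if "k \<in> {1..?n}" for k
    unfolding spn [symmetric] using that by (intro span_base imageI)
  \<comment> \<open>The values that \<open>J2n ** H\<close> must take on \<open>B\<close>;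
    injectivity of \<open>x\<close> allows the index to be read off from the vector.\<close>
  define f where "f v = ?J *v x (the_inv_into {1..<?n} x v + 1)" for v
  have f: "f (x k) = ?J *v x (k + 1)" if "k \<in> {1..<?n}" for k
    unfolding f_def the_inv_into_f_f [OF injB that] ..
  have "u \<bullet> f v = 0" if uv: "u \<in> B" "v \<in> B" for u v
  proof -
    obtain i k where ik: "i \<in> {1..<?n}" "u = x i" "k \<in> {1..<?n}" "v = x k"
      using uv by (auto simp: B_def)
    then have "x i \<in> L" "x (k + 1) \<in> L"
      by (auto intro: xL)
    then show ?thesis
      using assms(1) ik f by (simp add: lagrangian_def isotropic_def)
  qed
  then obtain K0 where K0: "transpose K0 = - K0" "\<And>v. v \<in> B \<Longrightarrow> K0 *v v = f v"
    using skew_matrix_extending [OF indB] by metis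
  \<comment> \<open>Since \<open>J2n\<close> is orthogonal, this inverts
    \<open>H \<mapsto> J2n ** H\<close>.\<close>
  define g where "g K = transpose ?J ** K" for K :: "real ^ ('n + 'n) ^ ('n + 'n)"
  have Jg: "?J ** g K = K" and gJ: "g (?J ** K) = K" for K
    by (simp_all add: g_def matrix_mul_assoc J2n_transpose_mult)
  have lin: "linear g"
  proof (rule linearI)
    show "g (K + K') = g K + g K'" for K K'
      by (simp add: g_def matrix_add_ldistrib)
    show "g (c *\<^sub>R K) = c *\<^sub>R g K" for c K
      by (simp add: g_def vec_eq_iff matrix_matrix_mult_def sum_distrib_left mult_ac)
  qed
  have mem: "H \<in> HK x \<longleftrightarrow> ?J ** H - K0 \<in> skew_null (span B)" for H
  proof -
    have 1: "(\<forall>v\<in>span B. (?J ** H - K0) *v v = 0) \<longleftrightarrow> (\<forall>v\<in>B. (?J ** H - K0) *v v = 0)"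
      using linear_eq_0_on_span [OF matrix_vector_mul_linear, of B "?J ** H - K0"] span_base [of _ B]
      by blast
    have 2: "H *v x k = x (k + 1) \<longleftrightarrow> (?J ** H - K0) *v x k = 0" if "k \<in> {1..<?n}" for k
    proof -
      have "K0 *v x k = ?J *v x (k + 1)"
        using K0(2) f that by (auto simp: B_def)
      moreover have "?J *v u = ?J *v w \<longleftrightarrow> u = w" for u w
      proof
        assume "?J *v u = ?J *v w"
        then have "transpose ?J *v (?J *v u) = transpose ?J *v (?J *v w)"
          by (rule arg_cong)
        then show "u = w"
          unfolding matrix_vector_mul_assoc J2n_transpose_mult by simp
      qed simp
      ultimately show ?thesis
        by (simp add: matrix_vector_mult_diff_rdistrib matrix_vector_mul_assoc [symmetric])
    qed
    have 3: "skew_hamiltonian H \<longleftrightarrow> transpose (?J ** H - K0) = - (?J ** H - K0)"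
      unfolding skew_hamiltonian_iff_skew transpose_diff K0(1)
      by (simp add: eq_neg_iff_add_eq_0 algebra_simps)
    show ?thesis
      unfolding HK_def skew_null_def mem_Collect_eq 1 3 using 2 by (simp add: B_def)
  qed
  \<comment> \<open>The solutions form a translate of a linear image of the homogeneous ones, which
    gives both affinity and dimension.\<close>
  have HK: "HK x = (+) (g K0) ` g ` skew_null (span B)"
  proof (intro set_eqI iffI)
    fix H assume "H \<in> HK x"
    moreover have "H = g K0 + g (?J ** H - K0)"
      by (simp add: linear_diff [OF lin] gJ)
    ultimately show "H \<in> (+) (g K0) ` g ` skew_null (span B)"
      using mem by blast
  next
    fix H assume "H \<in> (+) (g K0) ` g ` skew_null (span B)"
    then obtain K where "K \<in> skew_null (span B)" "H = g K0 + g K"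
      by blast
    then show "H \<in> HK x"
      by (simp add: mem matrix_add_ldistrib Jg)
  qed
  have sub: "subspace (g ` skew_null (span B))"
    using lin subspace_skew_null by (rule linear_subspace_image)
  have "inj g"
    by (metis injI Jg)
  then have "dim (g ` skew_null (span B)) = dim (skew_null (span B))"
    using lin by (intro dim_image_eq) (auto intro: inj_on_subset)
  also have "\<dots> = (CARD('n + 'n) - dim (span B)) choose 2"
    by (rule dim_skew_null) simp
  also have "dim (span B) = ?n - 1"
    using indB injB by (simp add: dim_eq_card_independent B_def card_image)
  \<comment> \<open>The truncated subtraction is exact because n is positive; for n = 1 the set
    \<open>B\<close> is empty.\<close>
  also have "CARD('n + 'n) - (?n - 1) = ?n + 1"
    using zero_less_card_finite [where 'a = 'n] by (simp add: card_UNIV_sum)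
  finally have dim: "dim (g ` skew_null (span B)) = (?n + 1) choose 2" .
  have "affine (HK x)"
    unfolding HK affine_translation [symmetric] using sub by (rule subspace_imp_affine)
  moreover have "aff_dim (HK x) = int ((?n + 1) choose 2)"
    by (simp add: HK aff_dim_translation_eq aff_dim_subspace [OF sub] dim)
  moreover have "real ((?n + 1) choose 2) = real ?n * (real ?n + 1) / 2"
    by (simp add: choose_two real_of_nat_div algebra_simps)
  ultimately show ?thesis
    by (simp only: of_int_of_nat_eq simp_thms)
qed

end
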